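(* Let $\mu$ be a probability measure on the Borel subsets of $\mathbb{R}$ that is symmetric (about $0$) and has a density $f$ with respect to Lebesgue measure that is weakly decreasing on $\mathbb{R}_+=[0,\infty)$. Then the noncentral family associated with $\mu$ has a discrete mixture representation.
   Context: Noncentral family associated with $\mu$: let $X$ be a random variable with distribution $\mu$. The family is $\{P_\theta:\theta\in\mathbb{R}\}$, where $P_\theta$ is the distribution of $(X+\theta)^2$, or alternatively the distribution of $|X+\theta|$. It is irrelevant for the existence of a discrete mixture representation which of the two is used, and the assertion applies to both. For symmetric $\mu$ one may restrict to $\theta\ge 0$, since $P_\theta=P_{-\theta}$. Discrete mixture representation: a family $\{P_\theta:\theta\in\Theta\}$ of probability measures on a measurable space $(S,\mathcal{S})$ has a discrete mixture representation if there exist a finite or countably infinite set $E$, a family $\{Q_i:i\in E\}$ of probability measures on $(S,\mathcal{S})$ (not depending on $\theta$), and for each $\theta\in\Theta$ a probability mass function $w_\theta$ on $E$, such that $P_\theta(A)=\sum_{i\in E}w_\theta(i)\,Q_i(A)$ for all $\theta\in\Theta$ and all $A\in\mathcal{S}$. Here $(S,\mathcal{S})$ is $\mathbb{R}$ (or $[0,\infty)$) with its Borel $\sigma$-field. *)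

theory Defs
  imports "HOL-Probability.Probability"
begin

text \<open>
  HOL cannot quantify existentially over the type of indices, so the finite or countably
  infinite index set is taken to be an arbitrary subset of the natural numbers; up to relabelling
  this covers every countable index set.
\<close>

definition discrete_mixture_representation ::
    "'s measure \<Rightarrow> 't set \<Rightarrow> ('t \<Rightarrow> 's measure) \<Rightarrow> bool" where
  "discrete_mixture_representation M \<Theta> P \<longleftrightarrow>
     (\<forall>\<theta>\<in>\<Theta>. prob_space (P \<theta>) \<and> sets (P \<theta>) = sets M) \<and>
     (\<exists>(E :: nat set) (Q :: nat \<Rightarrow> 's measure) (w :: 't \<Rightarrow> nat pmf).
        (\<forall>i\<in>E. prob_space (Q i) \<and> sets (Q i) = sets M) \<and>
        (\<forall>\<theta>\<in>\<Theta>. set_pmf (w \<theta>) \<subseteq> E) \<and>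
        (\<forall>\<theta>\<in>\<Theta>. \<forall>A\<in>sets M.
           ((\<lambda>i. pmf (w \<theta>) i * measure (Q i) A) has_sum measure (P \<theta>) A) E))"

definition noncentral_square :: "real measure \<Rightarrow> real \<Rightarrow> real measure" where
  "noncentral_square \<mu> \<theta> = distr \<mu> borel (\<lambda>x. (x + \<theta>)\<^sup>2)"

definition noncentral_abs :: "real measure \<Rightarrow> real \<Rightarrow> real measure" where
  "noncentral_abs \<mu> \<theta> = distr \<mu> borel (\<lambda>x. \<bar>x + \<theta>\<bar>)"

definition symmetric_measure :: "real measure \<Rightarrow> bool" where
  "symmetric_measure \<mu> \<longleftrightarrow> distr \<mu> borel uminus = \<mu>"

end

theory Submission
  imports Defs
begin

text \<open>
  A single countable family serves all shifts at once: the uniform distributions on the dyadic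
  intervals \<open>dyadic n k\<close> of all levels \<open>n\<close>. The point is that every density \<open>h\<close> that is lower
  semicontinuous almost everywhere is a nonnegative combination of indicators of such intervals.
  Replace \<open>h\<close> by its infimum over the level-\<open>n\<close> interval around each point. These step functions
  increase with \<open>n\<close>, because the intervals of successive levels are nested, and lower
  semicontinuity guarantees that their supremum is \<open>h\<close>. The increments between successive
  levels are therefore nonnegative, are constant on the intervals of the finer level, and add
  up to \<open>h\<close> (\<open>lower_semicontinuous_eq_sum_dyadic\<close>). The increment on an interval times its length
  is the weight of the corresponding uniform distribution, and the weights add up to one because
  \<open>h\<close> has integral one (\<open>discrete_mixture_representation_lower_semicontinuous_densities\<close>).

  For symmetric \<open>\<mu>\<close> the distribution of \<open>X + \<theta>\<close> has the density \<open>f \<bar>x - \<theta>\<bar>\<close>. As \<open>f\<close> is decreasing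
  on the positive half-line, it has only countably many discontinuities there, so this density is
  lower semicontinuous almost everywhere (\<open>AE_lower_semicontinuous_antimono_abs\<close>). Thus the
  translates of \<open>\<mu>\<close> have a discrete mixture representation, and image measures under a fixed map
  inherit one (\<open>discrete_mixture_representation_distr\<close>); the maps \<open>\<lambda>x. x\<^sup>2\<close> and \<open>\<lambda>x. \<bar>x\<bar>\<close> give
  the two versions of the noncentral family.
\<close>

section \<open>Establishing and transporting discrete mixture representations\<close>

text \<open>
  The representation may be checked with extended nonnegative weights, sums written as integrals
  over the counting measure, and any countable index type. That the weights are finite and add up
  to one is automatic: evaluate the identity on the whole space.
\<close>

lemma discrete_mixture_representationI:
  fixes M :: "'s measure" and Q :: "'i :: countable \<Rightarrow> 's measure"
    and W :: "'t \<Rightarrow> 'i \<Rightarrow> ennreal"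
  assumes P: "\<And>\<theta>. \<theta> \<in> \<Theta> \<Longrightarrow> prob_space (P \<theta>)" "\<And>\<theta>. \<theta> \<in> \<Theta> \<Longrightarrow> sets (P \<theta>) = sets M"
    and Q: "\<And>i. prob_space (Q i)" "\<And>i. sets (Q i) = sets M"
    and mix: "\<And>\<theta> A. \<theta> \<in> \<Theta> \<Longrightarrow> A \<in> sets M \<Longrightarrow>
      emeasure (P \<theta>) A = (\<integral>\<^sup>+ i. W \<theta> i * emeasure (Q i) A \<partial>count_space UNIV)"
  shows "discrete_mixture_representation M \<Theta> P"
proof -
  have "\<exists>w :: 'i pmf. \<forall>A\<in>sets M. ((\<lambda>i. pmf w i * measure (Q i) A) has_sum measure (P \<theta>) A) UNIV"
    if \<theta>: "\<theta> \<in> \<Theta>" for \<theta>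
  proof -
    interpret P: prob_space "P \<theta>" by (rule P[OF \<theta>])
    have total: "(\<integral>\<^sup>+ i. W \<theta> i \<partial>count_space UNIV) = 1"
    proof -
      have "space (Q i) = space M" "space (P \<theta>) = space M" for i
        by (rule sets_eq_imp_space_eq[OF Q(2)], rule sets_eq_imp_space_eq[OF P(2)[OF \<theta>]])
      then show ?thesis
        using mix[OF \<theta> sets.top] P.emeasure_space_1 prob_space.emeasure_space_1[OF Q(1)]
        by simp
    qed
    have fin: "W \<theta> i \<noteq> \<infinity>" for i
    proof -
      have "W \<theta> i \<le> (\<integral>\<^sup>+ i. W \<theta> i \<partial>count_space UNIV)"
        by (rule nn_integral_ge_point) simp
      then show ?thesis
        using total by (auto simp: top_unique)
    qed
    define w where "w = embed_pmf (\<lambda>i. enn2real (W \<theta> i))"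
    have w: "pmf w i = enn2real (W \<theta> i)" for i
      unfolding w_def using total fin
      by (intro pmf_embed_pmf) (simp_all add: less_top)
    have "((\<lambda>i. pmf w i * measure (Q i) A) has_sum measure (P \<theta>) A) UNIV" if A: "A \<in> sets M" for A
    proof -
      define g where "g i = pmf w i * measure (Q i) A" for i
      have g0: "0 \<le> g i" for i by (simp add: g_def)
      have "ennreal (g i) = W \<theta> i * emeasure (Q i) A" for i
      proof -
        interpret Qi: prob_space "Q i" by (rule Q)
        show ?thesis
          using fin[of i] by (simp add: g_def w ennreal_mult Qi.emeasure_eq_measure less_top)
      qed
      then have nn: "(\<integral>\<^sup>+ i. g i \<partial>count_space UNIV) = ennreal (measure (P \<theta>) A)"
        using mix[OF \<theta> A] by (simp add: P.emeasure_eq_measure)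
      have s: "Infinite_Set_Sum.abs_summable_on g UNIV"
        unfolding abs_summable_on_def
        using nn g0 by (intro integrableI_nonneg) auto
      then have "infsum g UNIV = measure (P \<theta>) A"
        using nn nn_integral_conv_infsetsum[OF s g0] g0
        by (simp add: infsetsum_infsum[symmetric] infsetsum_nonneg)
      moreover have "g summable_on UNIV"
        using s abs_summable_equivalent abs_summable_summable by blast
      ultimately show ?thesis
        unfolding g_def by (metis has_sum_infsum)
    qed
    then show ?thesis by blast
  qed
  then obtain w :: "'t \<Rightarrow> 'i pmf" where w: "\<And>\<theta> A. \<theta> \<in> \<Theta> \<Longrightarrow> A \<in> sets M \<Longrightarrow>
      ((\<lambda>i. pmf (w \<theta>) i * measure (Q i) A) has_sum measure (P \<theta>) A) UNIV"
    by metis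
  have "((\<lambda>j. pmf (map_pmf to_nat (w \<theta>)) j * measure (Q (from_nat j)) A) has_sum measure (P \<theta>) A)
      (range (to_nat :: 'i \<Rightarrow> nat))" if "\<theta> \<in> \<Theta>" "A \<in> sets M" for \<theta> A
    using w[OF that] by (simp add: has_sum_reindex o_def pmf_map_inj')
  then show ?thesis
    unfolding discrete_mixture_representation_def using P Q
    by (intro conjI ballI exI[of _ "range (to_nat :: 'i \<Rightarrow> nat)"]
        exI[of _ "\<lambda>j. Q (from_nat j)"] exI[of _ "\<lambda>\<theta>. map_pmf to_nat (w \<theta>)"]) auto
qed

text \<open>
  Forming image measures is linear in the measure, so the components may be mapped one by one
  while the weights stay the same.
\<close>

lemma discrete_mixture_representation_distr:
  assumes dmr: "discrete_mixture_representation M \<Theta> P" and g: "g \<in> measurable M N"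
  shows "discrete_mixture_representation N \<Theta> (\<lambda>\<theta>. distr (P \<theta>) N g)"
proof -
  have P: "prob_space (P \<theta>)" "sets (P \<theta>) = sets M" if "\<theta> \<in> \<Theta>" for \<theta>
    using dmr that by (simp_all add: discrete_mixture_representation_def)
  from dmr obtain E :: "nat set" and Q w where
      Q: "\<forall>i\<in>E. prob_space (Q i) \<and> sets (Q i) = sets M"
      and w: "\<forall>\<theta>\<in>\<Theta>. set_pmf (w \<theta>) \<subseteq> E"
      and mix: "\<forall>\<theta>\<in>\<Theta>. \<forall>A\<in>sets M.
        ((\<lambda>i. pmf (w \<theta>) i * measure (Q i) A) has_sum measure (P \<theta>) A) E"
    unfolding discrete_mixture_representation_def by (elim conjE exE) (rule that)
  have gP: "g \<in> measurable (P \<theta>) N" if "\<theta> \<in> \<Theta>" for \<theta>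
    using g by (simp add: measurable_cong_sets[OF P(2)[OF that] refl])
  have gQ: "g \<in> measurable (Q i) N" if "i \<in> E" for i
    using g Q that by (simp cong: measurable_cong_sets)
  have "((\<lambda>i. pmf (w \<theta>) i * measure (distr (Q i) N g) B) has_sum measure (distr (P \<theta>) N g) B) E"
    if \<theta>: "\<theta> \<in> \<Theta>" and B: "B \<in> sets N" for \<theta> B
  proof -
    have "space (Q i) = space M" if "i \<in> E" for i
      using Q that by (intro sets_eq_imp_space_eq) simp
    moreover have "space (P \<theta>) = space M"
      using P(2)[OF \<theta>] by (rule sets_eq_imp_space_eq)
    ultimately have mP: "measure (distr (P \<theta>) N g) B = measure (P \<theta>) (g -` B \<inter> space M)"
      and mQ: "\<And>i. i \<in> E \<Longrightarrow> measure (distr (Q i) N g) B = measure (Q i) (g -` B \<inter> space M)"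
      using gP[OF \<theta>] gQ B by (simp_all add: measure_distr)
    show ?thesis
      unfolding mP using mix[rule_format, OF \<theta> measurable_sets[OF g B]] mQ
      by (simp cong: has_sum_cong)
  qed
  then show ?thesis
    unfolding discrete_mixture_representation_def
    using prob_space.prob_space_distr[OF P(1) gP] prob_space.prob_space_distr[OF _ gQ] Q w
    by (intro conjI ballI exI[of _ E] exI[of _ "\<lambda>i. distr (Q i) N g"] exI[of _ w]) auto
qed

section \<open>Dyadic decomposition of lower semicontinuous functions\<close>

definition dyadic :: "nat \<Rightarrow> int \<Rightarrow> real set" where
  "dyadic n k = {real_of_int k / 2 ^ n ..< (real_of_int k + 1) / 2 ^ n}"

lemma mem_dyadic_iff: "x \<in> dyadic n k \<longleftrightarrow> k = \<lfloor>2 ^ n * x\<rfloor>"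
proof -
  have "x \<in> dyadic n k \<longleftrightarrow> real_of_int k \<le> 2 ^ n * x \<and> 2 ^ n * x < real_of_int k + 1"
    by (simp add: dyadic_def field_simps)
  also have "\<dots> \<longleftrightarrow> k = \<lfloor>2 ^ n * x\<rfloor>"
    using floor_eq_iff[of "2 ^ n * x" k] by auto
  finally show ?thesis .
qed

lemma dyadic_Suc_subset: "dyadic (Suc n) k \<subseteq> dyadic n (k div 2)"
proof
  fix x assume "x \<in> dyadic (Suc n) k"
  then have "k = \<lfloor>2 * (2 ^ n * x)\<rfloor>" by (simp add: mem_dyadic_iff mult.assoc)
  then have "k div 2 = \<lfloor>2 ^ n * x\<rfloor>" by linarith
  then show "x \<in> dyadic n (k div 2)" by (simp add: mem_dyadic_iff)
qed

lemma dyadic_measurable [measurable]: "dyadic n k \<in> sets borel"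
  by (simp add: dyadic_def)

lemma emeasure_dyadic: "emeasure lborel (dyadic n k) = ennreal (1 / 2 ^ n)"
  unfolding dyadic_def
  by (subst emeasure_lborel_Ico) (auto simp: field_simps)

definition dyadic_Inf :: "(real \<Rightarrow> ennreal) \<Rightarrow> nat \<Rightarrow> int \<Rightarrow> ennreal" where
  "dyadic_Inf h n k = (INF x\<in>dyadic n k. h x)"

text \<open>
  The interval \<open>dyadic n k\<close> lies in \<open>dyadic (n - 1) (k div 2)\<close>, so this is the gain in the infimum
  from passing to the finer level. At level 0 the infimum itself counts as the gain.
\<close>

definition dyadic_increment :: "(real \<Rightarrow> ennreal) \<Rightarrow> nat \<Rightarrow> int \<Rightarrow> ennreal" where
  "dyadic_increment h n k =
     dyadic_Inf h n k - (if n = 0 then 0 else dyadic_Inf h (n - 1) (k div 2))"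

lemma dyadic_Inf_le: "dyadic_Inf h n \<lfloor>2 ^ n * (x :: real)\<rfloor> \<le> h x"
  unfolding dyadic_Inf_def by (rule INF_lower) (simp add: mem_dyadic_iff)

lemma floor_div_2: "\<lfloor>2 ^ Suc n * x\<rfloor> div 2 = \<lfloor>2 ^ n * (x :: real)\<rfloor>"
  using dyadic_Suc_subset[of n "\<lfloor>2 ^ Suc n * x\<rfloor>"] mem_dyadic_iff by blast

lemma incseq_dyadic_Inf: "incseq (\<lambda>n. dyadic_Inf h n \<lfloor>2 ^ n * (x :: real)\<rfloor>)"
proof (rule incseq_SucI)
  fix n
  show "dyadic_Inf h n \<lfloor>2 ^ n * x\<rfloor> \<le> dyadic_Inf h (Suc n) \<lfloor>2 ^ Suc n * x\<rfloor>"
    unfolding dyadic_Inf_def floor_div_2[of n x, symmetric]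
    by (intro INF_superset_mono dyadic_Suc_subset) auto
qed

text \<open>
  Telescoping remains valid in the presence of infinite values, since \<open>x + (y - x) = y\<close> holds for
  all extended nonnegative reals \<open>x \<le> y\<close>.
\<close>

lemma suminf_increments_ennreal:
  fixes a :: "nat \<Rightarrow> ennreal"
  assumes "incseq a"
  shows "(\<Sum>n. a n - (if n = 0 then 0 else a (n - 1))) = (SUP n. a n)"
proof -
  have partial: "(\<Sum>i<Suc n. a i - (if i = 0 then 0 else a (i - 1))) = a n" for n
  proof (induction n)
    case (Suc n)
    then show ?case
      using incseq_SucD[OF assms, of n] by (simp add: add_diff_inverse_ennreal)
  qed simp
  have "(\<lambda>n. \<Sum>i<Suc n. a i - (if i = 0 then 0 else a (i - 1))) \<longlonglongrightarrow>
      (\<Sum>n. a n - (if n = 0 then 0 else a (n - 1)))"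
    by (subst filterlim_sequentially_Suc) (rule summable_LIMSEQ, simp)
  then have "a \<longlonglongrightarrow> (\<Sum>n. a n - (if n = 0 then 0 else a (n - 1)))"
    unfolding partial .
  with LIMSEQ_SUP[OF assms] show ?thesis
    by (rule LIMSEQ_unique[symmetric])
qed

text \<open>
  If \<open>h\<close> exceeds \<open>y\<close> on a neighbourhood of \<open>x\<close>, then it does so on all sufficiently short dyadic
  intervals around \<open>x\<close>, and the infimum over such an interval is at least \<open>y\<close>.
\<close>

lemma SUP_dyadic_Inf:
  assumes lsc: "\<And>y. y < h x \<Longrightarrow> \<forall>\<^sub>F z in nhds x. y < h z"
  shows "(SUP n. dyadic_Inf h n \<lfloor>2 ^ n * x\<rfloor>) = h x"
proof (rule antisym)
  show "(SUP n. dyadic_Inf h n \<lfloor>2 ^ n * x\<rfloor>) \<le> h x"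
    by (intro SUP_least dyadic_Inf_le)
  show "h x \<le> (SUP n. dyadic_Inf h n \<lfloor>2 ^ n * x\<rfloor>)"
  proof (rule dense_le)
    fix y assume "y < h x"
    from lsc[OF this] obtain d where d: "d > 0" "\<And>z. dist z x < d \<Longrightarrow> y < h z"
      by (auto simp: eventually_nhds_metric)
    obtain n where n: "(1 / 2) ^ n < d"
      using real_arch_pow_inv[OF d(1), of "1/2"] by auto
    have "y \<le> h z" if z: "z \<in> dyadic n \<lfloor>2 ^ n * x\<rfloor>" for z
    proof -
      have "\<lfloor>2 ^ n * x\<rfloor> = \<lfloor>2 ^ n * z\<rfloor>"
        using z by (simp add: mem_dyadic_iff)
      then have "\<bar>2 ^ n * z - 2 ^ n * x\<bar> < 1" by linarith
      then have "2 ^ n * \<bar>z - x\<bar> < 1"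
        by (simp add: abs_mult flip: right_diff_distrib)
      then have "dist z x < (1 / 2) ^ n"
        by (simp add: dist_real_def field_simps)
      with n d(2) show ?thesis by (meson less_imp_le less_trans)
    qed
    then have "y \<le> dyadic_Inf h n \<lfloor>2 ^ n * x\<rfloor>"
      unfolding dyadic_Inf_def by (rule INF_greatest)
    also have "\<dots> \<le> (SUP n. dyadic_Inf h n \<lfloor>2 ^ n * x\<rfloor>)"
      by (rule SUP_upper) simp
    finally show "y \<le> (SUP n. dyadic_Inf h n \<lfloor>2 ^ n * x\<rfloor>)" .
  qed
qed

text \<open>
  At each level exactly one dyadic interval contains \<open>x\<close>, so the double sum collapses to the
  telescoping series of the infima over the intervals around \<open>x\<close>.
\<close>

lemma lower_semicontinuous_eq_sum_dyadic:
  assumes "\<And>y. y < h x \<Longrightarrow> \<forall>\<^sub>F z in nhds x. y < h z"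
  shows "h x = (\<integral>\<^sup>+ (n, k). dyadic_increment h n k * indicator (dyadic n k) x \<partial>count_space UNIV)"
proof -
  have "(\<integral>\<^sup>+ (n, k). dyadic_increment h n k * indicator (dyadic n k) x \<partial>count_space UNIV) =
      (\<integral>\<^sup>+ n. \<integral>\<^sup>+ k. dyadic_increment h n k * indicator (dyadic n k) x
        \<partial>count_space UNIV \<partial>count_space UNIV)"
    by (subst nn_integral_fst_count_space[symmetric]) simp
  also have "\<dots> = (\<integral>\<^sup>+ n. dyadic_increment h n \<lfloor>2 ^ n * x\<rfloor> \<partial>count_space UNIV)"
  proof (rule nn_integral_cong)
    fix n :: nat
    have "(\<integral>\<^sup>+ k. dyadic_increment h n k * indicator (dyadic n k) x \<partial>count_space UNIV) =
        (\<integral>\<^sup>+ k. dyadic_increment h n k * indicator {\<lfloor>2 ^ n * x\<rfloor>} k \<partial>count_space UNIV)"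
      by (intro nn_integral_cong) (simp add: mem_dyadic_iff indicator_def)
    then show "(\<integral>\<^sup>+ k. dyadic_increment h n k * indicator (dyadic n k) x \<partial>count_space UNIV) =
        dyadic_increment h n \<lfloor>2 ^ n * x\<rfloor>"
      by simp
  qed
  also have "\<dots> = (\<Sum>n. dyadic_increment h n \<lfloor>2 ^ n * x\<rfloor>)"
    by (rule nn_integral_count_space_nat)
  also have "\<dots> = (\<Sum>n. dyadic_Inf h n \<lfloor>2 ^ n * x\<rfloor> -
      (if n = 0 then 0 else dyadic_Inf h (n - 1) \<lfloor>2 ^ (n - 1) * x\<rfloor>))"
  proof (rule suminf_cong)
    fix n
    show "dyadic_increment h n \<lfloor>2 ^ n * x\<rfloor> = dyadic_Inf h n \<lfloor>2 ^ n * x\<rfloor> -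
        (if n = 0 then 0 else dyadic_Inf h (n - 1) \<lfloor>2 ^ (n - 1) * x\<rfloor>)"
      using floor_div_2[of "n - 1" x] by (cases n) (simp_all add: dyadic_increment_def)
  qed
  also have "\<dots> = (SUP n. dyadic_Inf h n \<lfloor>2 ^ n * x\<rfloor>)"
    by (rule suminf_increments_ennreal[OF incseq_dyadic_Inf])
  also have "\<dots> = h x"
    by (rule SUP_dyadic_Inf[OF assms])
  finally show ?thesis ..
qed

text \<open>
  Integrating the pointwise decomposition over a Borel set and exchanging sum and integral turns
  it into a mixture of uniform distributions. The intervals do not depend on \<open>h\<close>; only the
  increments do, which is why one family of components suffices for all parameters.
\<close>

lemma discrete_mixture_representation_lower_semicontinuous_densities:
  fixes h :: "'t \<Rightarrow> real \<Rightarrow> ennreal"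
  assumes h[measurable]: "\<And>\<theta>. \<theta> \<in> \<Theta> \<Longrightarrow> h \<theta> \<in> borel_measurable borel"
    and prob: "\<And>\<theta>. \<theta> \<in> \<Theta> \<Longrightarrow> prob_space (density lborel (h \<theta>))"
    and lsc: "\<And>\<theta>. \<theta> \<in> \<Theta> \<Longrightarrow>
      AE x in lborel. \<forall>y<h \<theta> x. \<forall>\<^sub>F z in nhds x. y < h \<theta> z"
  shows "discrete_mixture_representation borel \<Theta> (\<lambda>\<theta>. density lborel (h \<theta>))"
proof (rule discrete_mixture_representationI)
  let ?Q = "\<lambda>(n, k). uniform_measure lborel (dyadic n k)"
  let ?W = "\<lambda>\<theta> (n, k). dyadic_increment (h \<theta>) n k * ennreal (1 / 2 ^ n)"
  show "prob_space (?Q i)" for i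
    by (cases i) (auto intro!: prob_space_uniform_measure simp: emeasure_dyadic)
  show "sets (?Q i) = sets borel" for i
    by (cases i) simp
  show "emeasure (density lborel (h \<theta>)) A = (\<integral>\<^sup>+ i. ?W \<theta> i * emeasure (?Q i) A \<partial>count_space UNIV)"
    if \<theta>[measurable]: "\<theta> \<in> \<Theta>" and A[measurable]: "A \<in> sets borel" for \<theta> A
  proof -
    have "emeasure (density lborel (h \<theta>)) A = (\<integral>\<^sup>+ x. h \<theta> x * indicator A x \<partial>lborel)"
      by (simp add: emeasure_density)
    also have "\<dots> = (\<integral>\<^sup>+ x. \<integral>\<^sup>+ (n, k). dyadic_increment (h \<theta>) n k *
        indicator (dyadic n k \<inter> A) x \<partial>count_space UNIV \<partial>lborel)"
    proof (rule nn_integral_cong_AE, use lsc[OF \<theta>] in eventually_elim)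
      fix x assume "\<forall>y<h \<theta> x. \<forall>\<^sub>F z in nhds x. y < h \<theta> z"
      then have "h \<theta> x * indicator A x = (\<integral>\<^sup>+ (n, k). dyadic_increment (h \<theta>) n k *
          indicator (dyadic n k) x \<partial>count_space UNIV) * indicator A x"
        using lower_semicontinuous_eq_sum_dyadic[of "h \<theta>" x] by simp
      also have "\<dots> = (\<integral>\<^sup>+ (n, k). dyadic_increment (h \<theta>) n k *
          indicator (dyadic n k \<inter> A) x \<partial>count_space UNIV)"
        by (simp add: indicator_inter_arith case_prod_unfold mult.assoc flip: nn_integral_multc)
      finally show "h \<theta> x * indicator A x = (\<integral>\<^sup>+ (n, k). dyadic_increment (h \<theta>) n k *
          indicator (dyadic n k \<inter> A) x \<partial>count_space UNIV)" .
    qed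
    also have "\<dots> = (\<integral>\<^sup>+ i. \<integral>\<^sup>+ x. (case i of (n, k) \<Rightarrow> dyadic_increment (h \<theta>) n k *
        indicator (dyadic n k \<inter> A) x) \<partial>lborel \<partial>count_space UNIV)"
      by (rule nn_integral_count_space_nn_integral) (auto split: prod.split)
    also have "\<dots> = (\<integral>\<^sup>+ (n, k). dyadic_increment (h \<theta>) n k *
        emeasure lborel (dyadic n k \<inter> A) \<partial>count_space UNIV)"
      by (rule nn_integral_cong) (auto simp: nn_integral_cmult_indicator split: prod.split)
    also have "\<dots> = (\<integral>\<^sup>+ i. ?W \<theta> i * emeasure (?Q i) A \<partial>count_space UNIV)"
    proof (rule nn_integral_cong, clarify)
      fix n :: nat and k :: int
      have "ennreal (1 / 2 ^ n) * (emeasure lborel (dyadic n k \<inter> A) / ennreal (1 / 2 ^ n)) =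
          emeasure lborel (dyadic n k \<inter> A)"
        by (subst ennreal_times_divide, subst mult.commute, rule ennreal_mult_divide_eq) auto
      then show "dyadic_increment (h \<theta>) n k * emeasure lborel (dyadic n k \<inter> A) =
          dyadic_increment (h \<theta>) n k * ennreal (1 / 2 ^ n) *
          emeasure (uniform_measure lborel (dyadic n k)) A"
        by (simp add: emeasure_dyadic mult.assoc)
    qed
    finally show ?thesis .
  qed
qed (use prob in auto)

section \<open>Symmetric densities decreasing on the positive half-line\<close>

lemma symmetric_density_AE:
  fixes f :: "real \<Rightarrow> ennreal"
  assumes f[measurable]: "f \<in> borel_measurable borel" and sym: "symmetric_measure (density lborel f)"
  shows "AE x in lborel. f x = f \<bar>x\<bar>"
proof -
  have "density lborel f = distr (density lborel f) borel uminus"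
    using sym by (simp add: symmetric_measure_def)
  also have "\<dots> = density (distr lborel borel uminus) (\<lambda>x. f (- x))"
    by (subst density_distr) auto
  also have "distr lborel borel uminus = (lborel :: real measure)"
    by (rule lborel_distr_uminus)
  finally have "AE x in lborel. f x = f (- x)"
    by (intro sigma_finite_measure.density_unique[OF sigma_finite_lborel]) auto
  then show ?thesis
    by eventually_elim (simp add: abs_if)
qed

text \<open>
  An infinite value at \<open>x > 0\<close> would force \<open>f\<close> to be infinite on all of \<open>[0, x]\<close>, contradicting
  integrability. The value at \<open>0\<close> may well be infinite.
\<close>

lemma antimono_density_finite:
  fixes f :: "real \<Rightarrow> ennreal"
  assumes f[measurable]: "f \<in> borel_measurable borel" and anti: "antimono_on {0..} f"
    and int: "(\<integral>\<^sup>+ x. f x \<partial>lborel) \<noteq> \<infinity>" and x: "x > 0"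
  shows "f x \<noteq> \<infinity>"
proof
  assume "f x = \<infinity>"
  have "f x * ennreal x = (\<integral>\<^sup>+ y. f x * indicator {0..x} y \<partial>lborel)"
    using x by (simp add: nn_integral_cmult_indicator)
  also have "\<dots> \<le> (\<integral>\<^sup>+ y. f y \<partial>lborel)"
    using anti x by (intro nn_integral_mono) (auto simp: monotone_on_def split: split_indicator)
  finally show False
    using int x \<open>f x = \<infinity>\<close> by (simp add: ennreal_top_mult top_unique)
qed

text \<open>
  A monotone function has at most countably many discontinuities, and the preimage of a countable
  set under \<open>\<lambda>x. \<bar>x - \<theta>\<bar>\<close> is countable, hence a null set. Finiteness of \<open>f\<close> off \<open>0\<close> allows the
  passage to the real-valued function \<open>g\<close>.
\<close>

lemma AE_lower_semicontinuous_antimono_abs: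
  fixes f :: "real \<Rightarrow> ennreal"
  assumes anti: "antimono_on {0..} f" and fin: "\<And>x. x > 0 \<Longrightarrow> f x \<noteq> \<infinity>"
  shows "AE x in lborel. \<forall>y<f \<bar>x - \<theta>\<bar>. \<forall>\<^sub>F z in nhds x. y < f \<bar>z - \<theta>\<bar>"
proof -
  define g where "g x = - enn2real (f x)" for x
  have "mono_on {0<..} g"
    using anti fin unfolding g_def monotone_on_def
    by (auto intro!: enn2real_mono simp: less_top)
  then have count: "countable {x \<in> {0<..}. \<not> isCont g x}"
    by (intro mono_on_ctble_discont_open) auto
  define N where "N = {x \<in> {0<..}. \<not> isCont g x}"
  \<comment> \<open>The preimage of the discontinuities under \<open>\<lambda>x. \<bar>x - \<theta>\<bar>\<close>, together with \<open>\<theta>\<close> itself, where \<open>f\<close>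
    may be infinite.\<close>
  define B where "B = insert \<theta> ((\<lambda>u. \<theta> + u) ` N \<union> (\<lambda>u. \<theta> - u) ` N)"
  have "countable B"
    using count by (simp add: B_def N_def)
  then have "AE x in lborel. x \<notin> B"
    by (intro AE_not_in countable_imp_null_set_lborel)
  then show ?thesis
  proof eventually_elim
    case (elim x)
    have pos: "\<bar>x - \<theta>\<bar> > 0" and cont: "isCont g \<bar>x - \<theta>\<bar>"
    proof -
      show pos: "\<bar>x - \<theta>\<bar> > 0" using elim by (auto simp: B_def)
      have "x = \<theta> + \<bar>x - \<theta>\<bar> \<or> x = \<theta> - \<bar>x - \<theta>\<bar>" by linarith
      with elim have "\<bar>x - \<theta>\<bar> \<notin> N" by (auto simp: B_def)
      with pos show "isCont g \<bar>x - \<theta>\<bar>" by (simp add: N_def)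
    qed
    have "isCont (\<lambda>z. g \<bar>z - \<theta>\<bar>) x"
      by (rule isCont_o2[where f = "\<lambda>z. \<bar>z - \<theta>\<bar>", OF _ cont]) (intro continuous_intros)
    then have "((\<lambda>z. g \<bar>z - \<theta>\<bar>) \<longlongrightarrow> g \<bar>x - \<theta>\<bar>) (nhds x)"
      by (simp add: isCont_def tendsto_nhds_iff)
    then have lim: "((\<lambda>z. ennreal (- g \<bar>z - \<theta>\<bar>)) \<longlongrightarrow> ennreal (- g \<bar>x - \<theta>\<bar>)) (nhds x)"
      by (intro tendsto_ennrealI tendsto_minus)
    have "((\<lambda>z. \<bar>z - \<theta>\<bar>) \<longlongrightarrow> \<bar>x - \<theta>\<bar>) (nhds x)"
      by (intro tendsto_intros filterlim_ident)
    from order_tendstoD(1)[OF this pos] have near: "\<forall>\<^sub>F z in nhds x. \<bar>z - \<theta>\<bar> > 0" .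
    have g: "ennreal (- g u) = f u" if "u > 0" for u
      using fin[OF that] by (simp add: g_def less_top)
    have "\<forall>\<^sub>F z in nhds x. y < f \<bar>z - \<theta>\<bar>" if "y < f \<bar>x - \<theta>\<bar>" for y
    proof -
      have "\<forall>\<^sub>F z in nhds x. y < ennreal (- g \<bar>z - \<theta>\<bar>)"
        using order_tendstoD(1)[OF lim] that g[OF pos] by simp
      with near show ?thesis
        by eventually_elim (simp add: g)
    qed
    then show ?case by blast
  qed
qed

theorem theorem4:
  fixes \<mu> :: "real measure" and f :: "real \<Rightarrow> ennreal"
  assumes "prob_space \<mu>" and "sets \<mu> = sets borel"
    and "symmetric_measure \<mu>"
    and "f \<in> borel_measurable borel" and "\<mu> = density lborel f"
    and "antimono_on {0..} f"
  shows "discrete_mixture_representation borel UNIV (noncentral_square \<mu>) \<and>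
         discrete_mixture_representation borel UNIV (noncentral_abs \<mu>)"
proof -
  note [measurable] = assms(4)
  \<comment> \<open>Symmetry enters here: only the values of \<open>f\<close> on the nonnegative half-line, where it is
    monotone, are used.\<close>
  define h where "h \<theta> x = f \<bar>x - \<theta>\<bar>" for \<theta> x :: real
  have [measurable]: "h \<theta> \<in> borel_measurable borel" for \<theta>
    unfolding h_def by measurable
  have \<mu>: "\<mu> = density lborel (h 0)"
    unfolding assms(5) h_def using symmetric_density_AE assms(3,4,5)
    by (intro density_cong) auto
  have shift: "distr \<mu> borel (\<lambda>x. x + \<theta>) = density lborel (h \<theta>)" for \<theta>
  proof -
    have "(\<lambda>x. x + \<theta>) = (+) \<theta>"
      by (simp add: fun_eq_iff)
    moreover have "(\<lambda>x. h \<theta> (\<theta> + x)) = h 0"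
      by (simp add: h_def fun_eq_iff)
    ultimately have "distr \<mu> borel (\<lambda>x. x + \<theta>) =
        distr (density lborel (\<lambda>x. h \<theta> (\<theta> + x))) borel ((+) \<theta>)"
      by (simp only: \<mu>)
    also have "\<dots> = density (distr lborel borel ((+) \<theta>)) (h \<theta>)"
      by (rule density_distr[symmetric]) auto
    finally show ?thesis
      by (simp only: lborel_distr_plus)
  qed
  have "(\<integral>\<^sup>+ x. f x \<partial>lborel) \<noteq> \<infinity>"
    using prob_space.emeasure_space_1[OF assms(1)] unfolding assms(5)
    by (simp add: emeasure_density)
  then have fin: "f x \<noteq> \<infinity>" if "x > 0" for x
    using antimono_density_finite[OF assms(4,6)] that by simp
  have [measurable_cong]: "sets \<mu> = sets borel"
    by (rule assms(2))
  have "discrete_mixture_representation borel UNIV (\<lambda>\<theta>. distr \<mu> borel (\<lambda>x. x + \<theta>))"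
    unfolding shift
  proof (rule discrete_mixture_representation_lower_semicontinuous_densities)
    show "prob_space (density lborel (h \<theta>))" for \<theta>
      unfolding shift[symmetric] by (intro prob_space.prob_space_distr assms(1)) simp
    show "AE x in lborel. \<forall>y<h \<theta> x. \<forall>\<^sub>F z in nhds x. y < h \<theta> z" for \<theta>
      unfolding h_def by (rule AE_lower_semicontinuous_antimono_abs[OF assms(6) fin])
  qed simp
  note push = discrete_mixture_representation_distr[OF this, where N = borel]
  have "noncentral_square \<mu> = (\<lambda>\<theta>. distr (distr \<mu> borel (\<lambda>x. x + \<theta>)) borel (\<lambda>x. x\<^sup>2))"
    by (auto simp: noncentral_square_def distr_distr o_def)
  moreover have "noncentral_abs \<mu> = (\<lambda>\<theta>. distr (distr \<mu> borel (\<lambda>x. x + \<theta>)) borel abs)"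
    by (auto simp: noncentral_abs_def distr_distr o_def)
  ultimately show ?thesis
    using push[of "\<lambda>x. x\<^sup>2"] push[of abs] by simp
qed

end
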